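(* Let $A\in \mathrm{M}(n,\mathbf{H})$ be a nonsingular Hermitian matrix, i.e. Hermitian with $\det A\neq 0$. Then there exist a unique right inverse matrix $(RA)^{-1}$ and a unique left inverse matrix $(LA)^{-1}$ of $A$, they satisfy $(RA)^{-1}=(LA)^{-1}=:A^{-1}$, and $$(RA)^{-1}=\frac{1}{\det A}\begin{pmatrix}R_{11}&R_{21}&\cdots&R_{n1}\\R_{12}&R_{22}&\cdots&R_{n2}\\ \cdots&\cdots&\cdots&\cdots\\R_{1n}&R_{2n}&\cdots&R_{nn}\end{pmatrix},\qquad (LA)^{-1}=\frac{1}{\det A}\begin{pmatrix}L_{11}&L_{21}&\cdots&L_{n1}\\L_{12}&L_{22}&\cdots&L_{n2}\\ \cdots&\cdots&\cdots&\cdots\\L_{1n}&L_{2n}&\cdots&L_{nn}\end{pmatrix},$$ where $R_{ij}$ and $L_{ij}$ are the right and left $ij$-th cofactors of $A$, respectively, for all $i,j=1,\ldots,n$.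
   Context: $\mathbf{H}$ is the skew field of real quaternions; $\mathrm{M}(n,\mathbf{H})$ is the ring of $n\times n$ matrices over $\mathbf{H}$; $A$ is Hermitian if it equals its conjugate transpose $A^*$. Row determinants: for $A=(a_{pq})\in \mathrm{M}(n,\mathbf{H})$ and $i\in\{1,\ldots,n\}$, $$\mathrm{rdet}_i A=\sum_{\sigma\in S_n}(-1)^{n-r}a_{i\,i_{k_1}}a_{i_{k_1}i_{k_1+1}}\cdots a_{i_{k_1+l_1}i}\cdots a_{i_{k_r}i_{k_r+1}}\cdots a_{i_{k_r+l_r}i_{k_r}},$$ where each $\sigma\in S_n$ is written as a product of its $r$ disjoint cycles (fixed points included) $\sigma=(i\,i_{k_1}i_{k_1+1}\ldots i_{k_1+l_1})(i_{k_2}\ldots i_{k_2+l_2})\ldots(i_{k_r}\ldots i_{k_r+l_r})$, each entry of a cycle being mapped to the next; the first cycle starts with $i$, every other cycle starts with its smallest element, and $i_{k_2}<i_{k_3}<\cdots<i_{k_r}$. A fixed point $p$ contributes the factor $a_{pp}$. Column determinants: for $j\in\{1,\ldots,n\}$, $$\mathrm{cdet}_j A=\sum_{\tau\in S_n}(-1)^{n-r}a_{j_{k_r}j_{k_r+l_r}}\cdots a_{j_{k_r+1}j_{k_r}}\cdots a_{j\,j_{k_1+l_1}}\cdots a_{j_{k_1+1}j_{k_1}}a_{j_{k_1}j},$$ where each $\tau\in S_n$ is written as $\tau=(j_{k_r+l_r}\ldots j_{k_r+1}j_{k_r})\ldots(j_{k_2+l_2}\ldots j_{k_2+1}j_{k_2})(j_{k_1+l_1}\ldots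 j_{k_1+1}j_{k_1}j)$; the rightmost cycle ends with $j$, every other cycle has its smallest element in the rightmost position, and $j_{k_2}<j_{k_3}<\cdots<j_{k_r}$. The same definitions apply to square matrices whose rows and columns are indexed by any finite set of integers (with $S_n$ replaced by the symmetric group of that set and $n$ by its size). For Hermitian $A$ all $\mathrm{rdet}_iA$ and $\mathrm{cdet}_jA$ coincide and are real; the common value is $\det A$. Cofactors: $a_{.i}$ and $a_{i.}$ are the $i$th column and row of $A$. The right cofactors $R_{ij}$, coming from the expansion $\mathrm{rdet}_iA=\sum_j a_{ij}R_{ij}$, are $R_{ij}=-\mathrm{rdet}_j\,A^{ii}_{.j}(a_{.i})$ for $i\neq j$ and $R_{ii}=\mathrm{rdet}_k\,A^{ii}$, $k=\min(\{1,\ldots,n\}\setminus\{i\})$; here $A^{ii}$ is $A$ with its $i$th row and column deleted, and $A^{ii}_{.j}(a_{.i})$ is obtained from $A$ by replacing the $j$th column with the $i$th column and then deleting the $i$th row and column (remaining rows and columns keep their original indices). The left cofactors $L_{ij}$, coming from the expansion $\mathrm{cdet}_jA=\sum_i L_{ij}a_{ij}$, are $L_{ij}=-\mathrm{cdet}_i\,A^{jj}_{i.}(a_{j.})$ for $i\neq j$ and $L_{jj}=\mathrm{cdet}_k\,A^{jj}$, $k=\min(\{1,\ldots,n\}\setminus\{j\})$, where $A^{jj}_{i.}(a_{j.})$ is obtained from $A$ by replacing the $i$th row with the $j$th row and then deleting the $j$th row and column. For $n=1$, $R_{11}=L_{11}=1$. *)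

theory Defs
  imports
    Complex_Main
    "HOL-Combinatorics.Cycles"
    "Jordan_Normal_Form.Matrix"
begin

section \<open>Real quaternions\<close>

codatatype quaternion =
  Quaternion (QRe: real) (QImI: real) (QImJ: real) (QImK: real)

lemma quaternion_eq_iff:
  "x = y \<longleftrightarrow> QRe x = QRe y \<and> QImI x = QImI y \<and> QImJ x = QImJ y \<and> QImK x = QImK y"
  by (auto intro: quaternion.expand)

instantiation quaternion :: ab_group_add
begin

primcorec zero_quaternion where
  "QRe 0 = 0"
| "QImI 0 = 0"
| "QImJ 0 = 0"
| "QImK 0 = 0"

primcorec plus_quaternion where
  "QRe (x + y) = QRe x + QRe y"
| "QImI (x + y) = QImI x + QImI y"
| "QImJ (x + y) = QImJ x + QImJ y"
| "QImK (x + y) = QImK x + QImK y"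

primcorec uminus_quaternion where
  "QRe (- x) = - QRe x"
| "QImI (- x) = - QImI x"
| "QImJ (- x) = - QImJ x"
| "QImK (- x) = - QImK x"

primcorec minus_quaternion where
  "QRe (x - y) = QRe x - QRe y"
| "QImI (x - y) = QImI x - QImI y"
| "QImJ (x - y) = QImJ x - QImJ y"
| "QImK (x - y) = QImK x - QImK y"

instance
  by standard (simp_all add: quaternion_eq_iff)

end

instantiation quaternion :: ring_1
begin

primcorec one_quaternion where
  "QRe 1 = 1"
| "QImI 1 = 0"
| "QImJ 1 = 0"
| "QImK 1 = 0"

primcorec times_quaternion where
  "QRe (x * y) = QRe x * QRe y - QImI x * QImI y - QImJ x * QImJ y - QImK x * QImK y"
| "QImI (x * y) = QRe x * QImI y + QImI x * QRe y + QImJ x * QImK y - QImK x * QImJ y"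
| "QImJ (x * y) = QRe x * QImJ y - QImI x * QImK y + QImJ x * QRe y + QImK x * QImI y"
| "QImK (x * y) = QRe x * QImK y + QImI x * QImJ y - QImJ x * QImI y + QImK x * QRe y"

instance
  by standard (simp_all add: quaternion_eq_iff algebra_simps)

end

instantiation quaternion :: real_algebra_1
begin

primcorec scaleR_quaternion where
  "QRe (scaleR r x) = r * QRe x"
| "QImI (scaleR r x) = r * QImI x"
| "QImJ (scaleR r x) = r * QImJ x"
| "QImK (scaleR r x) = r * QImK x"

instance
  by standard (simp_all add: quaternion_eq_iff algebra_simps)

end

primcorec qcnj :: "quaternion \<Rightarrow> quaternion" where
  "QRe (qcnj x) = QRe x"
| "QImI (qcnj x) = - QImI x"
| "QImJ (qcnj x) = - QImJ x"
| "QImK (qcnj x) = - QImK x"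

definition qnorm2 :: "quaternion \<Rightarrow> real" where
  "qnorm2 x = (QRe x)\<^sup>2 + (QImI x)\<^sup>2 + (QImJ x)\<^sup>2 + (QImK x)\<^sup>2"

lemma qnorm2_eq_0_iff: "qnorm2 x = 0 \<longleftrightarrow> x = 0"
proof
  assume *: "qnorm2 x = 0"
  have "(QRe x)\<^sup>2 = 0" "(QImI x)\<^sup>2 = 0" "(QImJ x)\<^sup>2 = 0" "(QImK x)\<^sup>2 = 0"
    using * zero_le_power2[of "QRe x"] zero_le_power2[of "QImI x"]
      zero_le_power2[of "QImJ x"] zero_le_power2[of "QImK x"]
    unfolding qnorm2_def by linarith+
  then show "x = 0"
    by (simp add: quaternion_eq_iff)
qed (simp add: qnorm2_def)

lemma mult_qcnj: "x * qcnj x = scaleR (qnorm2 x) 1" "qcnj x * x = scaleR (qnorm2 x) 1"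
  by (simp_all add: quaternion_eq_iff qnorm2_def power2_eq_square)

instantiation quaternion :: real_div_algebra
begin

definition "inverse x = scaleR (inverse (qnorm2 x)) (qcnj x)" for x :: quaternion

definition "x div y = x * inverse y" for x y :: quaternion

instance
proof
  fix x y :: quaternion
  show "inverse x * x = 1" "x * inverse x = 1" if "x \<noteq> 0"
    using that by (simp_all add: inverse_quaternion_def mult_qcnj qnorm2_eq_0_iff)
  show "x div y = x * inverse y"
    by (rule divide_quaternion_def)
  show "inverse (0 :: quaternion) = 0"
    by (simp add: inverse_quaternion_def quaternion_eq_iff)
qed

end


section \<open>Hermitian matrices, one-sided inverses\<close>

definition conj_transpose :: "quaternion mat \<Rightarrow> quaternion mat" where
  "conj_transpose A = mat (dim_col A) (dim_row A) (\<lambda>(i, j). qcnj (A $$ (j, i)))"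

definition hermitian :: "quaternion mat \<Rightarrow> bool" where
  "hermitian A \<longleftrightarrow> conj_transpose A = A"

definition is_right_inverse :: "quaternion mat \<Rightarrow> quaternion mat \<Rightarrow> bool" where
  "is_right_inverse A X \<longleftrightarrow> X \<in> carrier_mat (dim_col A) (dim_row A) \<and> inverts_mat A X"

definition is_left_inverse :: "quaternion mat \<Rightarrow> quaternion mat \<Rightarrow> bool" where
  "is_left_inverse A X \<longleftrightarrow> X \<in> carrier_mat (dim_col A) (dim_row A) \<and> inverts_mat X A"

definition right_inverse :: "quaternion mat \<Rightarrow> quaternion mat" where
  "right_inverse A = (THE X. is_right_inverse A X)"

definition left_inverse :: "quaternion mat \<Rightarrow> quaternion mat" where
  "left_inverse A = (THE X. is_left_inverse A X)"


section \<open>Row and column determinants\<close>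

text \<open>
  A square matrix with rows and columns indexed by a finite set \<open>I\<close> is a function
  \<open>a\<close> of two indices, of which only the values on \<open>I \<times> I\<close> matter. Matrices of type
  \<open>mat\<close> are indexed from \<open>0\<close>: \<open>{..<n}\<close> plays the role of \<open>{1, \<dots>, n}\<close>. The notions
  below depend only on the order of the indices, so this shift is harmless.

  In \<open>cycle_starts I \<sigma> i\<close> the element \<open>i\<close> comes first, followed in increasing order by the
  smallest elements of the cycles of \<open>\<sigma>\<close> on \<open>I\<close> (fixed points included) that do not
  contain \<open>i\<close>. The library's \<open>support \<sigma> p\<close> is the cycle \<open>[p, \<sigma> p, \<sigma> (\<sigma> p), \<dots>]\<close>;
  it is \<open>[p]\<close> for a fixed point.
\<close>

definition cycle_starts :: "nat set \<Rightarrow> (nat \<Rightarrow> nat) \<Rightarrow> nat \<Rightarrow> nat list" where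
  "cycle_starts I \<sigma> i =
     i # sorted_list_of_set {p \<in> I. p \<notin> set (support \<sigma> i) \<and> p = Min (set (support \<sigma> p))}"

text \<open>
  For a cycle \<open>[p, p\<^sub>1, \<dots>, p\<^sub>l]\<close> this is the product
  \<open>a p p\<^sub>1 * a p\<^sub>1 p\<^sub>2 * \<dots> * a p\<^sub>l p\<close>, in this order.
\<close>

definition cycle_prod ::
    "(nat \<Rightarrow> nat \<Rightarrow> 'a::ring_1) \<Rightarrow> (nat \<Rightarrow> nat) \<Rightarrow> nat \<Rightarrow> 'a" where
  "cycle_prod a \<sigma> p = prod_list (map (\<lambda>q. a q (\<sigma> q)) (support \<sigma> p))"

definition rdet :: "nat set \<Rightarrow> (nat \<Rightarrow> nat \<Rightarrow> 'a::ring_1) \<Rightarrow> nat \<Rightarrow> 'a" where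
  "rdet I a i =
     (\<Sum>\<sigma> | \<sigma> permutes I.
        (- 1) ^ (card I - length (cycle_starts I \<sigma> i)) *
        prod_list (map (cycle_prod a \<sigma>) (cycle_starts I \<sigma> i)))"

text \<open>
  In a column determinant a cycle is written \<open>(j\<^sub>l \<dots> j\<^sub>1 j)\<close> with its distinguished element
  \<open>j\<close> at the right end, and contributes \<open>a j j\<^sub>l * \<dots> * a j\<^sub>2 j\<^sub>1 * a j\<^sub>1 j\<close>. Since \<open>\<tau> j = j\<^sub>l\<close>,
  \<dots>, \<open>\<tau> j\<^sub>2 = j\<^sub>1\<close>, \<open>\<tau> j\<^sub>1 = j\<close>, this is \<open>cycle_prod a \<tau> j\<close>, just as for row determinants.
  The difference is in the order of the cycles, which is reversed: the cycle containing
  the chosen index contributes the last block of factors.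
\<close>

definition cdet :: "nat set \<Rightarrow> (nat \<Rightarrow> nat \<Rightarrow> 'a::ring_1) \<Rightarrow> nat \<Rightarrow> 'a" where
  "cdet I a j =
     (\<Sum>\<tau> | \<tau> permutes I.
        (- 1) ^ (card I - length (cycle_starts I \<tau> j)) *
        prod_list (map (cycle_prod a \<tau>) (rev (cycle_starts I \<tau> j))))"

definition entries :: "'a mat \<Rightarrow> nat \<Rightarrow> nat \<Rightarrow> 'a" where
  "entries A p q = A $$ (p, q)"

text \<open>
  The common real value of all row and column determinants; meaningful only for Hermitian
  matrices of positive size.
\<close>

definition hermitian_det :: "quaternion mat \<Rightarrow> real" where
  "hermitian_det A =
     (THE d. \<forall>i < dim_row A. rdet {..<dim_row A} (entries A) i = of_real d \<and>
                             cdet {..<dim_row A} (entries A) i = of_real d)"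


section \<open>Cofactors\<close>

definition replace_col :: "(nat \<Rightarrow> nat \<Rightarrow> 'a) \<Rightarrow> nat \<Rightarrow> (nat \<Rightarrow> 'a) \<Rightarrow> nat \<Rightarrow> nat \<Rightarrow> 'a" where
  "replace_col a j v = (\<lambda>p q. if q = j then v p else a p q)"

definition replace_row :: "(nat \<Rightarrow> nat \<Rightarrow> 'a) \<Rightarrow> nat \<Rightarrow> (nat \<Rightarrow> 'a) \<Rightarrow> nat \<Rightarrow> nat \<Rightarrow> 'a" where
  "replace_row a i v = (\<lambda>p q. if p = i then v q else a p q)"

text \<open>
  Deleting the \<open>i\<close>-th row and column means passing to the index set \<open>{..<n} - {i}\<close>. If \<open>i \<noteq> j\<close>,
  then \<open>n \<ge> 2\<close>, so the case \<open>n = 1\<close> only concerns the diagonal cofactor.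
\<close>

definition right_cofactor :: "quaternion mat \<Rightarrow> nat \<Rightarrow> nat \<Rightarrow> quaternion" where
  "right_cofactor A i j =
     (let n = dim_row A; a = entries A; I = {..<n} - {i} in
      if i \<noteq> j then - rdet I (replace_col a j (\<lambda>p. a p i)) j
      else if n = 1 then 1
      else rdet I a (Min I))"

definition left_cofactor :: "quaternion mat \<Rightarrow> nat \<Rightarrow> nat \<Rightarrow> quaternion" where
  "left_cofactor A i j =
     (let n = dim_row A; a = entries A; J = {..<n} - {j} in
      if i \<noteq> j then - cdet J (replace_row a i (\<lambda>q. a j q)) i
      else if n = 1 then 1
      else cdet J a (Min J))"

end

theory Submission
  imports Defs
begin

text \<open>
  The idea is to read all row and column determinants as sums over walks on the index set.
  Splitting off the cycle through \<open>i\<close> turns the row determinant along \<open>i\<close> into a signed sum,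
  over the closed walks at \<open>i\<close> with distinct vertices, of the product of the entries along the
  walk times the determinant of the indices left over (\<open>rdet_cycle_expansion\<close>; for column
  determinants the two factors are exchanged, \<open>cdet_cycle_expansion\<close>).

  For a Hermitian matrix this expansion shows by induction that all determinants of an index
  set coincide and are real (\<open>hermitian_dets_coincide\<close>). Reversing a closed walk conjugates
  its product, so each expansion is real. Comparing the expansions along \<open>i\<close> and \<open>k\<close> after
  expanding once more (\<open>signed_walks_two_base_points\<close>), they agree up to the order of two
  factors, which is invisible to the real part.

  Replacing a column or a row as in the cofactors turns closed walks at an index into walks
  between two different indices. As the leftover determinants are real and hence central, left
  and right cofactors are the same sums over walks, the entries of one adjugate matrix
  (\<open>right_cofactor_eq\<close>, \<open>left_cofactor_eq\<close>). That the matrix times its adjugate is the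
  determinant times the identity is a cancellation between walks from \<open>i\<close> to \<open>k\<close> that return
  to \<open>i\<close> and those that do not (\<open>matrix_times_adjugate\<close>). The adjugate is Hermitian as well,
  so conjugate transposition gives the product in the other order. A matrix with a two-sided
  inverse has no other one-sided inverse.
\<close>

section \<open>Conjugation and real quaternions\<close>

lemma qcnj_mult: "qcnj (x * y) = qcnj y * qcnj x"
  by (simp add: quaternion_eq_iff algebra_simps)

lemma qcnj_add: "qcnj (x + y) = qcnj x + qcnj y"
  by (simp add: quaternion_eq_iff)

lemma qcnj_sum: "qcnj (sum f S) = (\<Sum>s\<in>S. qcnj (f s))"
proof (induction S rule: infinite_finite_induct)
qed (simp_all add: qcnj_add quaternion_eq_iff)

lemma QRe_sum: "QRe (sum f S) = (\<Sum>s\<in>S. QRe (f s))"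
proof (induction S rule: infinite_finite_induct)
qed simp_all

lemma of_real_components:
  "QRe (of_real r) = r" "QImI (of_real r) = 0" "QImJ (of_real r) = 0" "QImK (of_real r) = 0"
  by (simp_all add: of_real_def)

lemma quaternion_real_iff: "x \<in> \<real> \<longleftrightarrow> qcnj x = x"
proof
  assume "qcnj x = x"
  then have "x = of_real (QRe x)"
    by (simp add: quaternion_eq_iff of_real_components)
  then show "x \<in> \<real>" by (metis Reals_of_real)
qed (auto simp: Reals_def quaternion_eq_iff of_real_components)

lemma quaternion_real_eq: "x \<in> \<real> \<Longrightarrow> x = of_real (QRe x)"
  by (auto simp: Reals_def of_real_components)

lemma real_central: "x \<in> \<real> \<Longrightarrow> x * y = y * x" for x y :: quaternion
  by (auto simp: Reals_def quaternion_eq_iff of_real_components algebra_simps)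

section \<open>Lists without repetition and walks\<close>

definition distinct_lists :: "'b set \<Rightarrow> 'b list set" where
  "distinct_lists S = {xs. distinct xs \<and> set xs \<subseteq> S}"

lemma finite_distinct_lists [simp]: "finite S \<Longrightarrow> finite (distinct_lists S)"
  using finite_subset_distinct[of S] by (simp add: distinct_lists_def conj_commute)

lemma Nil_in_distinct_lists [simp]: "[] \<in> distinct_lists S"
  by (simp add: distinct_lists_def)

lemma bij_betw_rev_distinct_lists: "bij_betw rev (distinct_lists S) (distinct_lists S)"
  by (rule bij_betwI[where g = rev]) (auto simp: distinct_lists_def)

lemma sum_distinct_lists_hd:
  assumes "finite S"
  shows "sum f (distinct_lists S) = f [] + (\<Sum>j\<in>S. \<Sum>ys\<in>distinct_lists (S - {j}). f (j # ys))"
proof -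
  have "sum f (distinct_lists S) = f [] + sum f (distinct_lists S - {[]})"
    using assms by (subst sum.remove[of _ "[]"]) auto
  also have "sum f (distinct_lists S - {[]}) = (\<Sum>(j, ys) \<in> (SIGMA j:S. distinct_lists (S - {j})). f (j # ys))"
    by (rule sum.reindex_bij_witness[where i = "\<lambda>(j, ys). j # ys" and j = "\<lambda>xs. (hd xs, tl xs)"])
      (auto simp: distinct_lists_def neq_Nil_conv)
  also have "\<dots> = (\<Sum>j\<in>S. \<Sum>ys\<in>distinct_lists (S - {j}). f (j # ys))"
    using assms by (subst sum.Sigma) auto
  finally show ?thesis .
qed

text \<open>
  Splitting a walk at an intermediate vertex \<open>k\<close> is the combinatorial step that turns
  one cycle into two, or an open walk into a cycle followed by an open walk.
\<close>

lemma sum_distinct_lists_split: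
  assumes "finite S" "k \<notin> S"
  shows "sum f (distinct_lists (insert k S)) =
    sum f (distinct_lists S) + (\<Sum>us\<in>distinct_lists S. \<Sum>vs\<in>distinct_lists (S - set us). f (us @ k # vs))"
proof -
  let ?T = "distinct_lists (insert k S)"
  have "sum f ?T = sum f {xs\<in>?T. k \<notin> set xs} + sum f {xs\<in>?T. k \<in> set xs}"
    using assms by (subst sum.union_disjoint[symmetric]) (auto intro: arg_cong[where f = "sum f"])
  also have "{xs\<in>?T. k \<notin> set xs} = distinct_lists S"
    using assms by (auto simp: distinct_lists_def)
  also have "sum f {xs\<in>?T. k \<in> set xs} =
      (\<Sum>(us, vs) \<in> (SIGMA us:distinct_lists S. distinct_lists (S - set us)). f (us @ k # vs))"
  proof (rule sum.reindex_bij_witness[where i = "\<lambda>(us, vs). us @ k # vs" and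
        j = "\<lambda>xs. (takeWhile (\<lambda>x. x \<noteq> k) xs, tl (dropWhile (\<lambda>x. x \<noteq> k) xs))"], goal_cases)
    case (1 xs)
    then obtain us vs where xs: "xs = us @ k # vs" "k \<notin> set us"
      by (auto dest: split_list_first)
    then have "takeWhile (\<lambda>x. x \<noteq> k) xs = us" "dropWhile (\<lambda>x. x \<noteq> k) xs = k # vs"
      by (auto simp: takeWhile_append dropWhile_append)
    with xs show ?case by simp
  next
    case (2 xs)
    then obtain us vs where xs: "xs = us @ k # vs" "k \<notin> set us"
      by (auto dest: split_list_first)
    then have "takeWhile (\<lambda>x. x \<noteq> k) xs = us" "dropWhile (\<lambda>x. x \<noteq> k) xs = k # vs"
      by (auto simp: takeWhile_append dropWhile_append)
    with 2 xs show ?case by (auto simp: distinct_lists_def)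
  next
    case (3 p)
    then have "k \<notin> set (fst p)" using assms by (auto simp: distinct_lists_def)
    then show ?case by (cases p) (auto simp: takeWhile_append dropWhile_append)
  next
    case (4 p)
    then show ?case using assms by (cases p) (auto simp: distinct_lists_def)
  next
    case (5 xs)
    then obtain us vs where xs: "xs = us @ k # vs" "k \<notin> set us"
      by (auto dest: split_list_first)
    then have "takeWhile (\<lambda>x. x \<noteq> k) xs = us" "dropWhile (\<lambda>x. x \<noteq> k) xs = k # vs"
      by (auto simp: takeWhile_append dropWhile_append)
    with xs show ?case by simp
  qed
  also have "\<dots> = (\<Sum>us\<in>distinct_lists S. \<Sum>vs\<in>distinct_lists (S - set us). f (us @ k # vs))"
    using assms by (subst sum.Sigma) auto
  finally show ?thesis .
qed

lemma sum_distinct_lists_swap: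
  assumes "finite S"
  shows "(\<Sum>us\<in>distinct_lists S. \<Sum>vs\<in>distinct_lists (S - set us). g us vs) =
    (\<Sum>vs\<in>distinct_lists S. \<Sum>us\<in>distinct_lists (S - set vs). g us vs)"
proof -
  have "(\<Sum>(us, vs) \<in> (SIGMA us:distinct_lists S. distinct_lists (S - set us)). g us vs) =
    (\<Sum>(vs, us) \<in> (SIGMA vs:distinct_lists S. distinct_lists (S - set vs)). g us vs)"
    by (rule sum.reindex_bij_witness[where i = prod.swap and j = prod.swap]) (auto simp: distinct_lists_def)
  then show ?thesis
    using assms by (simp add: sum.Sigma)
qed

text \<open>
  A walk is given by its vertices except the last one, so that the closed walk through \<open>xs\<close>
  is \<open>walk a xs (hd xs)\<close>, and concatenation of walks is concatenation of lists.
\<close>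

primrec walk :: "('b \<Rightarrow> 'b \<Rightarrow> 'a::ring_1) \<Rightarrow> 'b list \<Rightarrow> 'b \<Rightarrow> 'a" where
  "walk a [] y = 1"
| "walk a (x # xs) y = a x (hd (xs @ [y])) * walk a xs y"

lemma walk_append: "walk a (xs @ ys) z = walk a xs (hd (ys @ [z])) * walk a ys z"
  by (induction xs) (auto simp: mult.assoc hd_append)

lemma walk_map2: "walk a xs y = prod_list (map2 a xs (tl xs @ [y]))"
proof (induction xs)
  case (Cons x xs)
  then show ?case by (cases xs) auto
qed simp

lemma walk_cong:
  assumes "\<And>p q. p \<in> set xs \<Longrightarrow> q \<in> insert y (set (tl xs)) \<Longrightarrow> a p q = b p q"
  shows "walk a xs y = walk b xs y"
  using assms
proof (induction xs)
  case (Cons x xs)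
  have "walk a xs y = walk b xs y"
    using Cons.prems by (intro Cons.IH) (auto dest: list.set_sel(2)[rotated])
  moreover have "a x (hd (xs @ [y])) = b x (hd (xs @ [y]))"
    by (rule Cons.prems) (cases xs; simp)+
  ultimately show ?case by simp
qed simp

text \<open>
  Conjugation reverses a product and, for a Hermitian matrix, swaps the indices of each
  factor; both effects together reverse the walk.
\<close>

lemma walk_rev:
  fixes a :: "'b \<Rightarrow> 'b \<Rightarrow> quaternion"
  assumes "\<And>p q. p \<in> insert x (insert y (set xs)) \<Longrightarrow> q \<in> insert x (insert y (set xs)) \<Longrightarrow> a q p = qcnj (a p q)"
  shows "qcnj (walk a (x # xs) y) = walk a (y # rev xs) x"
  using assms
proof (induction xs arbitrary: x)
  case Nil
  have "a y x = qcnj (a x y)"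
    by (rule Nil) simp_all
  then show ?case by simp
next
  case (Cons z xs)
  have "qcnj (walk a (z # xs) y) = walk a (y # rev xs) z"
    by (rule Cons.IH, rule Cons.prems) auto
  moreover have "a z x = qcnj (a x z)"
    by (rule Cons.prems) simp_all
  moreover have "walk a (y # rev (z # xs)) x = walk a (y # rev xs) z * a z x"
    using walk_append[of a "y # rev xs" "[z]" x] by simp
  ultimately show ?case
    by (simp add: qcnj_mult)
qed

section \<open>Splitting off the cycle through a given index\<close>

lemma support_cong:
  assumes "\<And>q. q \<in> S \<Longrightarrow> f q = g q" "\<And>q. q \<in> S \<Longrightarrow> g q \<in> S" "p \<in> S"
  shows "support f p = support g p"
proof -
  have "(f ^^ k) p = (g ^^ k) p \<and> (g ^^ k) p \<in> S" for k
    by (induction k) (simp_all add: assms)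
  then show ?thesis
    by (simp add: least_power_def)
qed

lemma support_cycle_of_list:
  assumes "distinct xs" "xs \<noteq> []"
  shows "support (cycle_of_list xs) (hd xs) = xs"
proof -
  have pow: "(cycle_of_list xs ^^ n) (hd xs) = xs ! (n mod length xs)" for n
  proof -
    have "(cycle_of_list xs ^^ n) (hd xs) = hd (map (cycle_of_list xs ^^ n) xs)"
      using assms by (simp add: hd_map)
    also have "\<dots> = xs ! (n mod length xs)"
      using assms by (subst cyclic_rotation) (simp_all add: hd_rotate_conv_nth)
    finally show ?thesis .
  qed
  have "least_power (cycle_of_list xs) (hd xs) = length xs"
    unfolding least_power_def
  proof (rule Least_equality)
    show "(cycle_of_list xs ^^ length xs) (hd xs) = hd xs \<and> 0 < length xs"
      using assms pow[of "length xs"] by (simp add: hd_conv_nth)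
  next
    fix n assume n: "(cycle_of_list xs ^^ n) (hd xs) = hd xs \<and> 0 < n"
    then have "xs ! (n mod length xs) = xs ! 0"
      using assms pow[of n] by (simp add: hd_conv_nth)
    then have "n mod length xs = 0"
      using assms by (subst (asm) nth_eq_iff_index_eq) auto
    then show "length xs \<le> n"
      using n by (auto intro: dvd_imp_le)
  qed
  then show ?thesis
    by (auto intro!: nth_equalityI simp: pow)
qed

context
  fixes xs :: "'b list" and \<tau> :: "'b \<Rightarrow> 'b" and J :: "'b set"
  assumes xs: "distinct xs" and \<tau>: "\<tau> permutes J" and disj: "J \<inter> set xs = {}"
begin

lemma cycle_comp_apply:
  "q \<in> set xs \<Longrightarrow> (cycle_of_list xs \<circ> \<tau>) q = cycle_of_list xs q"
  "q \<in> J \<Longrightarrow> (cycle_of_list xs \<circ> \<tau>) q = \<tau> q"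
proof -
  show "(cycle_of_list xs \<circ> \<tau>) q = cycle_of_list xs q" if "q \<in> set xs"
    using that disj permutes_not_in[OF \<tau>] by (metis IntI comp_apply empty_iff)
  show "(cycle_of_list xs \<circ> \<tau>) q = \<tau> q" if "q \<in> J"
    using that disj permutes_in_image[OF \<tau>]
    by (metis IntI comp_apply empty_iff id_outside_supp)
qed

lemma support_cycle_comp:
  "xs \<noteq> [] \<Longrightarrow> support (cycle_of_list xs \<circ> \<tau>) (hd xs) = xs"
  "q \<in> J \<Longrightarrow> support (cycle_of_list xs \<circ> \<tau>) q = support \<tau> q"
proof -
  show "support (cycle_of_list xs \<circ> \<tau>) (hd xs) = xs" if "xs \<noteq> []"
  proof -
    have "support (cycle_of_list xs \<circ> \<tau>) (hd xs) = support (cycle_of_list xs) (hd xs)"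
    proof (rule support_cong[of "set xs"])
      fix q assume q: "q \<in> set xs"
      show "(cycle_of_list xs \<circ> \<tau>) q = cycle_of_list xs q"
        by (rule cycle_comp_apply(1)[OF q])
      show "cycle_of_list xs q \<in> set xs"
        using q by (simp only: permutes_in_image[OF cycle_permutes])
    qed (rule list.set_sel(1)[OF that])
    also have "\<dots> = xs"
      by (rule support_cycle_of_list[OF xs that])
    finally show ?thesis .
  qed
  show "support (cycle_of_list xs \<circ> \<tau>) q = support \<tau> q" if "q \<in> J"
  proof (rule support_cong[of J])
    fix q assume q: "q \<in> J"
    show "(cycle_of_list xs \<circ> \<tau>) q = \<tau> q"
      by (rule cycle_comp_apply(2)[OF q])
    show "\<tau> q \<in> J"
      using q by (simp only: permutes_in_image[OF \<tau>])
  qed (rule that)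
qed

end

lemma support_properties:
  assumes "\<sigma> permutes I" "finite I" "p \<in> I"
  shows "distinct (support \<sigma> p)" "set (support \<sigma> p) \<subseteq> I" "support \<sigma> p = p # tl (support \<sigma> p)"
proof -
  have perm: "permutation \<sigma>"
    using assms permutation_permutes by blast
  show "distinct (support \<sigma> p)"
    by (rule cycle_of_permutation[OF perm])
  show "set (support \<sigma> p) \<subseteq> I"
    using assms permutes_in_image[OF permutes_funpow[OF assms(1)]] by auto
  show "support \<sigma> p = p # tl (support \<sigma> p)"
    using least_power_of_permutation(2)[OF perm, of p]
    by (simp add: upt_conv_Cons)
qed

text \<open>
  A permutation of \<open>I\<close> amounts to its cycle \<open>i # ys\<close> through \<open>i\<close> together with an arbitrary
  permutation of the remaining elements.
\<close>

lemma sum_permutes_split_cycle: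
  fixes F :: "('b \<Rightarrow> 'b) \<Rightarrow> 'c::comm_monoid_add"
  assumes "finite I" "i \<in> I"
  shows "(\<Sum>\<sigma> | \<sigma> permutes I. F \<sigma>) =
    (\<Sum>ys\<in>distinct_lists (I - {i}). \<Sum>\<tau> | \<tau> permutes (I - insert i (set ys)).
      F (cycle_of_list (i # ys) \<circ> \<tau>))"
proof -
  let ?S = "SIGMA ys:distinct_lists (I - {i}). {\<tau>. \<tau> permutes (I - insert i (set ys))}"
  let ?rest = "\<lambda>\<sigma> y. if y \<in> I - set (support \<sigma> i) then \<sigma> y else y"
  have "(\<Sum>\<sigma> | \<sigma> permutes I. F \<sigma>) =
    (\<Sum>(ys, \<tau>) \<in> ?S. F (cycle_of_list (i # ys) \<circ> \<tau>))"
  proof (rule sum.reindex_bij_witness[where j = "\<lambda>\<sigma>. (tl (support \<sigma> i), ?rest \<sigma>)" and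
        i = "\<lambda>(ys, \<tau>). cycle_of_list (i # ys) \<circ> \<tau>"])
    fix \<sigma> assume "\<sigma> \<in> {\<sigma>. \<sigma> permutes I}"
    then have \<sigma>: "\<sigma> permutes I" by simp
    have perm: "permutation \<sigma>"
      using \<sigma> assms permutation_permutes by blast
    obtain ys where ys: "support \<sigma> i = i # ys"
      using support_properties(3)[OF \<sigma> assms] by (rule that)
    have dist: "distinct (i # ys)" and sub: "set (i # ys) \<subseteq> I"
      using support_properties(1,2)[OF \<sigma> assms] unfolding ys .
    define \<tau> where "\<tau> = (\<lambda>y. if y \<in> I - set (i # ys) then \<sigma> y else y)"
    have \<tau>: "\<tau> permutes (I - set (i # ys))"
      using semidecomposition[OF \<sigma> assms(1), of i] unfolding ys \<tau>_def .
    have "cycle_of_list (i # ys) (\<tau> q) = \<sigma> q" for q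
    proof (cases "q \<in> set (i # ys)")
      case True
      then have "\<tau> q = q" by (auto simp: \<tau>_def)
      with True show ?thesis
        using cycle_restrict[OF perm, of q i] unfolding ys by metis
    next
      case False
      then have "\<tau> q = \<sigma> q"
        using permutes_not_in[OF \<sigma>] by (auto simp: \<tau>_def)
      moreover have "\<tau> q \<notin> set (i # ys)"
        using False permutes_in_image[OF \<tau>, of q] permutes_not_in[OF \<tau>, of q]
        by (cases "q \<in> I") auto
      ultimately show ?thesis using id_outside_supp by metis
    qed
    then have eq: "cycle_of_list (i # ys) \<circ> \<tau> = \<sigma>" by auto
    show "(case (tl (support \<sigma> i), ?rest \<sigma>) of (ys, \<tau>) \<Rightarrow> cycle_of_list (i # ys) \<circ> \<tau>) = \<sigma>"
      using eq unfolding ys list.sel prod.case \<tau>_def .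
    then show "(case (tl (support \<sigma> i), ?rest \<sigma>) of (ys, \<tau>) \<Rightarrow> F (cycle_of_list (i # ys) \<circ> \<tau>)) = F \<sigma>"
      by simp
    have "(ys, \<tau>) \<in> ?S"
      using \<tau> dist sub by (auto simp: distinct_lists_def)
    then show "(tl (support \<sigma> i), ?rest \<sigma>) \<in> ?S"
      unfolding ys list.sel \<tau>_def .
  next
    fix p assume p: "p \<in> ?S"
    then obtain ys \<tau> where p_eq: "p = (ys, \<tau>)" and ys: "distinct (i # ys)" "set (i # ys) \<subseteq> I"
      and \<tau>: "\<tau> permutes (I - set (i # ys))"
      using assms by (auto simp: distinct_lists_def)
    let ?\<sigma> = "cycle_of_list (i # ys) \<circ> \<tau>"
    have disj: "(I - set (i # ys)) \<inter> set (i # ys) = {}" by auto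
    have supp: "support ?\<sigma> i = i # ys"
      using support_cycle_comp(1)[OF ys(1) \<tau> disj] by simp
    have "?rest ?\<sigma> = \<tau>"
    proof
      show "?rest ?\<sigma> q = \<tau> q" for q
        using cycle_comp_apply(2)[OF ys(1) \<tau> disj, of q] permutes_not_in[OF \<tau>, of q]
        unfolding supp by (cases "q \<in> I - set (i # ys)") (simp_all only: if_True if_False simp_thms)
    qed
    then show "(tl (support (case p of (ys, \<tau>) \<Rightarrow> cycle_of_list (i # ys) \<circ> \<tau>) i),
        ?rest (case p of (ys, \<tau>) \<Rightarrow> cycle_of_list (i # ys) \<circ> \<tau>)) = p"
      unfolding p_eq prod.case supp list.sel by (simp only:)
    have "?\<sigma> permutes I"
      by (rule permutes_compose[OF permutes_subset[OF \<tau>] permutes_subset[OF cycle_permutes ys(2)]])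
        auto
    then show "(case p of (ys, \<tau>) \<Rightarrow> cycle_of_list (i # ys) \<circ> \<tau>) \<in> {\<sigma>. \<sigma> permutes I}"
      by (simp add: p_eq)
  qed
  also have "\<dots> = (\<Sum>ys\<in>distinct_lists (I - {i}). \<Sum>\<tau> | \<tau> permutes (I - insert i (set ys)).
      F (cycle_of_list (i # ys) \<circ> \<tau>))"
    using assms by (subst sum.Sigma) (auto intro: finite_permutations)
  finally show ?thesis .
qed

text \<open>
  The starting points of all cycles, without the one distinguished in \<open>cycle_starts\<close>. If the
  cycle of \<open>i\<close> is removed from a permutation, these are the starting points that remain, and
  they are again of the form \<open>cycle_starts\<close> with the least index distinguished. This makes
  row and column determinants recursive.
\<close>

definition cycle_minima :: "nat set \<Rightarrow> (nat \<Rightarrow> nat) \<Rightarrow> nat list" where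
  "cycle_minima J \<tau> = sorted_list_of_set {p \<in> J. p = Min (set (support \<tau> p))}"

lemma set_cycle_minima: "finite J \<Longrightarrow> set (cycle_minima J \<tau>) \<subseteq> J"
  by (auto simp: cycle_minima_def)

lemma length_cycle_minima: "finite J \<Longrightarrow> length (cycle_minima J \<tau>) \<le> card J"
  by (simp add: cycle_minima_def card_mono)

lemma cycle_starts_Min:
  assumes "finite J" "J \<noteq> {}" "\<tau> permutes J"
  shows "cycle_starts J \<tau> (Min J) = cycle_minima J \<tau>"
proof -
  let ?m = "Min J" and ?T = "{p \<in> J. p = Min (set (support \<tau> p))}"
  have m: "?m \<in> J" using assms by simp
  note supp = support_properties[OF assms(3,1)]
  have "?m \<in> set (support \<tau> ?m)"
    using supp(3)[OF m] by (metis list.set_intros(1))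
  then have "Min (set (support \<tau> ?m)) = ?m"
    using supp(2)[OF m] assms(1) by (intro Min_eqI) (auto intro: Min_le)
  then have mT: "?m \<in> ?T" using m by simp
  then have Min_T: "Min ?T = ?m"
    using assms(1) by (intro Min_eqI) (auto intro: Min_le)
  have T_eq: "{p \<in> J. p \<notin> set (support \<tau> ?m) \<and> p = Min (set (support \<tau> p))} = ?T - {?m}"
  proof -
    have perm: "permutation \<tau>"
      using assms permutation_permutes by blast
    have "p = ?m" if "p \<in> ?T" "p \<in> set (support \<tau> ?m)" for p
    proof -
      have "?m \<in> set (support \<tau> p)"
        using that disjoint_support'[OF perm, of p ?m] disjoint_support'[OF perm, of ?m p]
        by (metis Int_commute)
      then have "Min (set (support \<tau> p)) \<le> ?m"
        by (rule Min_le[OF List.finite_set])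
      moreover have "p = Min (set (support \<tau> p))"
        using that(1) unfolding mem_Collect_eq by (rule conjunct2)
      ultimately have "p \<le> ?m" by (simp only:)
      moreover have "?m \<le> p" using that assms by auto
      ultimately show ?thesis by simp
    qed
    then show ?thesis using \<open>?m \<in> set (support \<tau> ?m)\<close> by blast
  qed
  have "sorted_list_of_set ?T = Min ?T # sorted_list_of_set (?T - {Min ?T})"
    using mT assms(1) by (intro sorted_list_of_set_nonempty) auto
  then show ?thesis
    unfolding cycle_starts_def cycle_minima_def T_eq Min_T by (rule sym)
qed

lemma cycle_starts_cycle_comp:
  assumes "distinct (i # ys)" "set (i # ys) \<subseteq> I" "\<tau> permutes (I - set (i # ys))"
  shows "cycle_starts I (cycle_of_list (i # ys) \<circ> \<tau>) i = i # cycle_minima (I - set (i # ys)) \<tau>"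
proof -
  let ?\<sigma> = "cycle_of_list (i # ys) \<circ> \<tau>" and ?J = "I - set (i # ys)"
  have disj: "?J \<inter> set (i # ys) = {}" by auto
  have "support ?\<sigma> i = i # ys"
    using support_cycle_comp(1)[OF assms(1,3) disj] by simp
  then have "{p \<in> I. p \<notin> set (support ?\<sigma> i) \<and> p = Min (set (support ?\<sigma> p))} =
    {p \<in> ?J. p = Min (set (support ?\<sigma> p))}" by auto
  also have "\<dots> = {p \<in> ?J. p = Min (set (support \<tau> p))}"
    using support_cycle_comp(2)[OF assms(1,3) disj] by (metis (no_types, lifting))
  finally show ?thesis
    unfolding cycle_starts_def cycle_minima_def by simp
qed

lemma cycle_prod_cycle_comp:
  assumes "distinct (i # ys)" "set (i # ys) \<subseteq> I" "finite I" "\<tau> permutes (I - set (i # ys))"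
  shows "cycle_prod a (cycle_of_list (i # ys) \<circ> \<tau>) i = walk a (i # ys) i"
    and "p \<in> I - set (i # ys) \<Longrightarrow> cycle_prod a (cycle_of_list (i # ys) \<circ> \<tau>) p = cycle_prod a \<tau> p"
proof -
  let ?xs = "i # ys" and ?J = "I - set (i # ys)"
  let ?\<sigma> = "cycle_of_list ?xs \<circ> \<tau>"
  have disj: "?J \<inter> set ?xs = {}" by auto
  note app = cycle_comp_apply[OF assms(1,4) disj] and supp = support_cycle_comp[OF assms(1,4) disj]
  have "support ?\<sigma> i = ?xs"
    using supp(1) by simp
  then have "cycle_prod a ?\<sigma> i = prod_list (map (\<lambda>q. a q (?\<sigma> q)) ?xs)"
    by (simp only: cycle_prod_def)
  also have "map (\<lambda>q. a q (?\<sigma> q)) ?xs = map (\<lambda>q. a q (cycle_of_list ?xs q)) ?xs"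
    by (rule map_cong[OF refl]) (simp only: app(1))
  also have "\<dots> = map2 a ?xs (map (cycle_of_list ?xs) ?xs)"
    by (simp only: zip_map2 map_zip_map2 map_map) (simp add: zip_same_conv_map del: cycle_of_list.simps)
  also have "map (cycle_of_list ?xs) ?xs = tl ?xs @ [i]"
    using cyclic_rotation[OF assms(1), of 1] by simp
  finally show "cycle_prod a ?\<sigma> i = walk a ?xs i"
    by (simp only: walk_map2)
  assume p: "p \<in> ?J"
  have eq: "?\<sigma> q = \<tau> q" if "q \<in> set (support \<tau> p)" for q
    using that support_properties(2)[OF assms(4) _ p] assms(3) by (intro app(2)) blast
  have "map (\<lambda>q. a q (?\<sigma> q)) (support \<tau> p) = map (\<lambda>q. a q (\<tau> q)) (support \<tau> p)"
    by (rule map_cong[OF refl], rule arg_cong[of _ _ "a _"], rule eq)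
  then show "cycle_prod a ?\<sigma> p = cycle_prod a \<tau> p"
    unfolding cycle_prod_def supp(2)[OF p] by (simp only:)
qed

section \<open>Cycle expansion of row and column determinants\<close>

text \<open>
  The empty determinant has no distinguished index and must be \<open>1\<close> for the recursion to
  include permutations that consist of a single cycle.
\<close>

definition min_rdet :: "(nat \<Rightarrow> nat \<Rightarrow> 'a::ring_1) \<Rightarrow> nat set \<Rightarrow> 'a" where
  "min_rdet a J = (if J = {} then 1 else rdet J a (Min J))"

definition min_cdet :: "(nat \<Rightarrow> nat \<Rightarrow> 'a::ring_1) \<Rightarrow> nat set \<Rightarrow> 'a" where
  "min_cdet a J = (if J = {} then 1 else cdet J a (Min J))"

lemma min_rdet_altdef:
  assumes "finite J"
  shows "min_rdet a J = (\<Sum>\<tau> | \<tau> permutes J.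
    (- 1) ^ (card J - length (cycle_minima J \<tau>)) * prod_list (map (cycle_prod a \<tau>) (cycle_minima J \<tau>)))"
  using assms cycle_starts_Min[of J]
  by (auto simp: min_rdet_def rdet_def cycle_minima_def[of "{}"] intro!: sum.cong)

lemma min_cdet_altdef:
  assumes "finite J"
  shows "min_cdet a J = (\<Sum>\<tau> | \<tau> permutes J.
    (- 1) ^ (card J - length (cycle_minima J \<tau>)) *
    prod_list (map (cycle_prod a \<tau>) (rev (cycle_minima J \<tau>))))"
  using assms cycle_starts_Min[of J]
  by (auto simp: min_cdet_def cdet_def cycle_minima_def[of "{}"] intro!: sum.cong)

lemma minus_one_power_commute: "(- 1) ^ n * x = x * (- 1) ^ n" for x :: "'a::ring_1"
  by (cases "even n") auto

lemma cycle_comp_term: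
  fixes a :: "nat \<Rightarrow> nat \<Rightarrow> 'a::ring_1"
  assumes "finite I" "i \<in> I" "ys \<in> distinct_lists (I - {i})" "\<tau> permutes (I - insert i (set ys))"
  defines "J \<equiv> I - insert i (set ys)" and "\<sigma> \<equiv> cycle_of_list (i # ys) \<circ> \<tau>"
  shows "(- 1) ^ (card I - length (cycle_starts I \<sigma> i)) =
      (- 1) ^ length ys * (- 1 :: 'a) ^ (card J - length (cycle_minima J \<tau>))"
    and "map (cycle_prod a \<sigma>) (cycle_starts I \<sigma> i) =
      walk a (i # ys) i # map (cycle_prod a \<tau>) (cycle_minima J \<tau>)"
proof -
  have ys: "distinct (i # ys)" "set (i # ys) \<subseteq> I" and \<tau>: "\<tau> permutes (I - set (i # ys))"
    using assms(2-4) by (auto simp: distinct_lists_def)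
  have J: "J = I - set (i # ys)" "finite J" using assms(1) by (auto simp: J_def)
  have starts: "cycle_starts I \<sigma> i = i # cycle_minima J \<tau>"
    unfolding \<sigma>_def J by (rule cycle_starts_cycle_comp[OF ys \<tau>])
  have "card J = card I - card (set (i # ys))" "card (set (i # ys)) \<le> card I"
    unfolding J using ys(2) assms(1) by (auto intro!: card_Diff_subset card_mono)
  then have "card I - length (cycle_starts I \<sigma> i) = length ys + (card J - length (cycle_minima J \<tau>))"
    using length_cycle_minima[OF J(2), of \<tau>] distinct_card[OF ys(1)] by (simp add: starts)
  then show "(- 1) ^ (card I - length (cycle_starts I \<sigma> i)) =
      (- 1) ^ length ys * (- 1 :: 'a) ^ (card J - length (cycle_minima J \<tau>))"
    by (simp only: power_add)
  have "map (cycle_prod a \<sigma>) (cycle_minima J \<tau>) = map (cycle_prod a \<tau>) (cycle_minima J \<tau>)"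
    using cycle_prod_cycle_comp(2)[OF ys assms(1) \<tau>] set_cycle_minima[OF J(2), of \<tau>]
    unfolding \<sigma>_def J by (intro map_cong refl) blast
  moreover have "cycle_prod a \<sigma> i = walk a (i # ys) i"
    unfolding \<sigma>_def by (rule cycle_prod_cycle_comp(1)[OF ys assms(1) \<tau>])
  ultimately show "map (cycle_prod a \<sigma>) (cycle_starts I \<sigma> i) =
      walk a (i # ys) i # map (cycle_prod a \<tau>) (cycle_minima J \<tau>)"
    by (simp only: starts list.map)
qed

text \<open>
  The cycle of \<open>i\<close> contributes the leftmost block of factors, and the other cycles form a term
  of the determinant of the complementary index set. A cycle with \<open>length ys + 1\<close> elements
  has sign \<open>(- 1) ^ length ys\<close>.
\<close>

lemma rdet_cycle_expansion:
  assumes "finite I" "i \<in> I"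
  shows "rdet I a i = (\<Sum>ys\<in>distinct_lists (I - {i}).
    (- 1) ^ length ys * walk a (i # ys) i * min_rdet a (I - insert i (set ys)))"
  unfolding rdet_def sum_permutes_split_cycle[OF assms]
proof (rule sum.cong[OF refl], goal_cases)
  case (1 ys)
  let ?J = "I - insert i (set ys)"
  have "finite ?J" using assms by simp
  show ?case
    unfolding min_rdet_altdef[OF \<open>finite ?J\<close>] sum_distrib_left
  proof (rule sum.cong[OF refl], goal_cases)
    case (1 \<tau>)
    then have "\<tau> permutes ?J" by simp
    note t = cycle_comp_term[OF assms \<open>ys \<in> _\<close> this]
    show ?case
      unfolding t prod_list.Cons
      by (metis (no_types, lifting) minus_one_power_commute mult.assoc)
  qed
qed

lemma cdet_cycle_expansion:
  assumes "finite I" "i \<in> I"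
  shows "cdet I a i = (\<Sum>ys\<in>distinct_lists (I - {i}).
    (- 1) ^ length ys * min_cdet a (I - insert i (set ys)) * walk a (i # ys) i)"
  unfolding cdet_def sum_permutes_split_cycle[OF assms]
proof (rule sum.cong[OF refl], goal_cases)
  case (1 ys)
  let ?J = "I - insert i (set ys)"
  have "finite ?J" using assms by simp
  show ?case
    unfolding min_cdet_altdef[OF \<open>finite ?J\<close>] sum_distrib_left sum_distrib_right
  proof (rule sum.cong[OF refl], goal_cases)
    case (1 \<tau>)
    then have "\<tau> permutes ?J" by simp
    note t = cycle_comp_term[OF assms \<open>ys \<in> _\<close> this]
    show ?case
      unfolding rev_map[symmetric] t
      by (simp add: mult.assoc)
  qed
qed

section \<open>The adjugate as a sum over walks\<close>

text \<open>
  For \<open>x = y\<close> this is the cycle expansion of a determinant of \<open>J\<close> along \<open>x\<close>, where \<open>D\<close> gives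
  the determinants of the smaller index sets. For \<open>x \<noteq> y\<close> it is, up to sign, an off-diagonal
  cofactor.
\<close>

definition signed_walks ::
    "('b set \<Rightarrow> 'a) \<Rightarrow> ('b \<Rightarrow> 'b \<Rightarrow> 'a::ring_1) \<Rightarrow> 'b set \<Rightarrow> 'b \<Rightarrow> 'b \<Rightarrow> 'a" where
  "signed_walks D a J x y = (\<Sum>ys\<in>distinct_lists (J - {x, y}).
     (- 1) ^ length ys * walk a (x # ys) y * D (J - insert x (insert y (set ys))))"

definition adjugate ::
    "('b set \<Rightarrow> 'a) \<Rightarrow> ('b \<Rightarrow> 'b \<Rightarrow> 'a::ring_1) \<Rightarrow> 'b set \<Rightarrow> 'b \<Rightarrow> 'b \<Rightarrow> 'a" where
  "adjugate D a J x y = (if x = y then D (J - {y}) else - signed_walks D a J x y)"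

lemma rdet_eq_signed_walks:
  "finite J \<Longrightarrow> i \<in> J \<Longrightarrow> rdet J a i = signed_walks (min_rdet a) a J i i"
  by (simp add: rdet_cycle_expansion signed_walks_def)

text \<open>
  Prepending \<open>i\<close> to the walks that define column \<open>k\<close> of the adjugate gives all walks from
  \<open>i\<close> to \<open>k\<close> whose later vertices are distinct. For \<open>i = k\<close> this is the cycle expansion of
  \<open>D I\<close>. For \<open>i \<noteq> k\<close> a walk that returns to \<open>i\<close> is a cycle at \<open>i\<close> followed by a walk that
  does not return; summing over the cycles for a fixed remainder gives, by the cycle
  expansion of \<open>D\<close>, minus the term of the remainder alone. Hence walks that return cancel
  walks that do not. Isolating the sum over the cycles moves a value of \<open>D\<close> past the
  remainder, which is possible because the values of \<open>D\<close> are central.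
\<close>

lemma matrix_times_adjugate:
  fixes a :: "'b \<Rightarrow> 'b \<Rightarrow> 'a::ring_1"
  assumes "finite I"
    and central: "\<And>J x. J \<subseteq> I \<Longrightarrow> D J * x = x * D J"
    and cyc: "\<And>J i. J \<subseteq> I \<Longrightarrow> i \<in> J \<Longrightarrow> signed_walks D a J i i = D J"
    and "i \<in> I" "k \<in> I"
  shows "(\<Sum>j\<in>I. a i j * adjugate D a I j k) = (if i = k then D I else 0)"
proof -
  \<comment> \<open>\<open>xs\<close> lists the vertices strictly between \<open>i\<close> and \<open>k\<close>; it may contain \<open>i\<close>.\<close>
  define f where "f xs = (- 1) ^ length xs * walk a (i # xs) k * D (I - insert k (set xs))" for xs
  have f_Cons: "(\<Sum>ys\<in>distinct_lists (I - {k} - {j}). f (j # ys)) = a i j * - signed_walks D a I j k" for j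
  proof -
    have "I - {k} - {j} = I - {j, k}" by auto
    moreover have "f (j # ys) =
      a i j * - ((- 1) ^ length ys * walk a (j # ys) k * D (I - insert j (insert k (set ys))))" for ys
    proof -
      have "f (j # ys) = - ((- 1) ^ length ys * a i j) * walk a (j # ys) k * D (I - insert j (insert k (set ys)))"
        by (simp add: f_def mult.assoc insert_commute)
      then show ?thesis
        unfolding minus_one_power_commute[of "length ys" "a i j"] by (simp add: mult.assoc)
    qed
    ultimately show ?thesis
      unfolding signed_walks_def by (simp only: sum_negf[symmetric] sum_distrib_left)
  qed
  have "(\<Sum>j\<in>I. a i j * adjugate D a I j k) =
    a i k * D (I - {k}) + (\<Sum>j\<in>I - {k}. a i j * - signed_walks D a I j k)"
    using \<open>finite I\<close> \<open>k \<in> I\<close> by (subst sum.remove) (auto simp: adjugate_def intro!: sum.cong)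
  also have "a i k * D (I - {k}) = f []"
    by (simp add: f_def)
  also have "f [] + (\<Sum>j\<in>I - {k}. a i j * - signed_walks D a I j k) = sum f (distinct_lists (I - {k}))"
    using \<open>finite I\<close> by (simp only: sum_distinct_lists_hd f_Cons finite_Diff)
  also have "\<dots> = (if i = k then D I else 0)"
  proof (cases "i = k")
    case True
    then have "sum f (distinct_lists (I - {k})) = signed_walks D a I k k"
      by (simp add: f_def signed_walks_def)
    then show ?thesis using True cyc \<open>k \<in> I\<close> by simp
  next
    case False
    define S where "S = I - {i, k}"
    have S: "finite S" "i \<notin> S" "I - {k} = insert i S"
      using False assms by (auto simp: S_def)
    have return: "(\<Sum>us\<in>distinct_lists (S - set vs). f (us @ i # vs)) = - f vs" if vs: "vs \<in> distinct_lists S" for vs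
    proof -
      define J where "J = I - insert k (set vs)"
      have J: "J \<subseteq> I" "i \<in> J" "S - set vs = J - {i}"
        using vs False assms by (auto simp: J_def S_def distinct_lists_def)
      have "f (us @ i # vs) = - ((- 1) ^ length vs *
          ((- 1) ^ length us * walk a (i # us) i * D (J - insert i (set us))) * walk a (i # vs) k)" for us
      proof -
        have "I - insert k (set (us @ i # vs)) = J - insert i (set us)"
          by (auto simp: J_def)
        moreover have "walk a (i # us @ i # vs) k = walk a (i # us) i * walk a (i # vs) k"
          using walk_append[of a "i # us" "i # vs" k] by simp
        moreover have "length (us @ i # vs) = Suc (length vs + length us)"
          by simp
        ultimately have "f (us @ i # vs) = - ((- 1) ^ length vs * (- 1) ^ length us *
            (walk a (i # us) i * (walk a (i # vs) k * D (J - insert i (set us)))))"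
          unfolding f_def by (simp only: power_add power_Suc mult.assoc mult_minus_left mult_1_left)
        moreover have "walk a (i # vs) k * D (J - insert i (set us)) = D (J - insert i (set us)) * walk a (i # vs) k"
          by (rule sym, rule central) (use J(1) in blast)
        ultimately show ?thesis
          by (simp add: mult.assoc del: walk.simps)
      qed
      then have "(\<Sum>us\<in>distinct_lists (S - set vs). f (us @ i # vs)) =
          - ((- 1) ^ length vs * signed_walks D a J i i * walk a (i # vs) k)"
        by (simp add: J(3) signed_walks_def sum_negf sum_distrib_left sum_distrib_right del: walk.simps)
      also have "\<dots> = - f vs"
        using cyc[OF J(1,2)] central[OF J(1)]
        by (simp add: f_def J_def mult.assoc del: walk.simps)
      finally show ?thesis .
    qed
    have "(\<Sum>us\<in>distinct_lists S. \<Sum>vs\<in>distinct_lists (S - set us). f (us @ i # vs)) =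
        (\<Sum>vs\<in>distinct_lists S. \<Sum>us\<in>distinct_lists (S - set vs). f (us @ i # vs))"
      by (rule sum_distinct_lists_swap[OF S(1)])
    also have "\<dots> = (\<Sum>vs\<in>distinct_lists S. - f vs)"
      by (rule sum.cong[OF refl return])
    finally have "(\<Sum>us\<in>distinct_lists S. \<Sum>vs\<in>distinct_lists (S - set us). f (us @ i # vs)) = - sum f (distinct_lists S)"
      by (simp only: sum_negf)
    then show ?thesis
      using False S by (simp add: sum_distinct_lists_split)
  qed
  finally show ?thesis .
qed

section \<open>Determinants of Hermitian matrices\<close>

lemma minus_one_power_real: "(- 1) ^ n \<in> (\<real> :: quaternion set)"
  by (simp add: Reals_power)

text \<open>
  Reversing the list of inner vertices permutes the index set of the sum, and by
  \<open>walk_rev\<close> it conjugates the walk factor of each term; the other factors are real.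
\<close>

lemma qcnj_signed_walks:
  fixes a :: "'b \<Rightarrow> 'b \<Rightarrow> quaternion"
  assumes herm: "\<And>p q. p \<in> J \<Longrightarrow> q \<in> J \<Longrightarrow> a q p = qcnj (a p q)"
    and real: "\<And>K. K \<subset> J \<Longrightarrow> D K \<in> \<real>"
    and "x \<in> J" "y \<in> J"
  shows "qcnj (signed_walks D a J x y) = signed_walks D a J y x"
proof -
  have "qcnj (signed_walks D a J x y) = (\<Sum>ys\<in>distinct_lists (J - {y, x}).
      (- 1) ^ length (rev ys) * walk a (y # rev ys) x * D (J - insert y (insert x (set (rev ys)))))"
    unfolding signed_walks_def qcnj_sum
  proof (rule sum.cong)
    fix ys assume "ys \<in> distinct_lists (J - {y, x})"
    then have sub: "insert x (insert y (set ys)) \<subseteq> J"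
      using assms by (auto simp: distinct_lists_def)
    have w: "qcnj (walk a (x # ys) y) = walk a (y # rev ys) x"
      by (rule walk_rev, rule herm) (use sub in blast)+
    have d: "D (J - insert x (insert y (set ys))) \<in> \<real>"
      by (rule real) (use \<open>x \<in> J\<close> in blast)
    have "qcnj ((- 1) ^ length ys * walk a (x # ys) y * D (J - insert x (insert y (set ys)))) =
      D (J - insert x (insert y (set ys))) * (qcnj (walk a (x # ys) y) * (- 1) ^ length ys)"
      using d minus_one_power_real[of "length ys"]
      by (simp only: qcnj_mult quaternion_real_iff)
    also have "\<dots> = (- 1) ^ length ys * walk a (y # rev ys) x * D (J - insert x (insert y (set ys)))"
      unfolding w minus_one_power_commute[of "length ys"] by (rule real_central[OF d])
    finally show "qcnj ((- 1) ^ length ys * walk a (x # ys) y * D (J - insert x (insert y (set ys)))) =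
      (- 1) ^ length (rev ys) * walk a (y # rev ys) x * D (J - insert y (insert x (set (rev ys))))"
      by (simp add: insert_commute del: walk.simps)
  qed (simp add: insert_commute)
  also have "\<dots> = signed_walks D a J y x"
    unfolding signed_walks_def by (rule sum.reindex_bij_betw[OF bij_betw_rev_distinct_lists])
  finally show ?thesis .
qed

lemma QRe_mult_swap_real: "c \<in> \<real> \<Longrightarrow> QRe (x * y * c) = QRe (y * x * c)"
  by (auto simp: Reals_def of_real_components algebra_simps)

lemma minus_one_powers_collect:
  "(- 1) ^ m * x * ((- 1) ^ n * y * c) = x * y * ((- 1) ^ (m + n) * c)" for x :: "'a::ring_1"
  by (cases "even m"; cases "even n") (simp_all add: mult.assoc)

text \<open>
  A cycle at \<open>i\<close> either avoids \<open>k\<close>, in which case the complementary determinant can be expanded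
  along \<open>k\<close> and yields a second cycle, or it visits \<open>k\<close> and consists of a walk from \<open>i\<close> to
  \<open>k\<close> and one from \<open>k\<close> to \<open>i\<close>. Both kinds of terms are indexed by the same pairs of disjoint
  lists, which makes the expansion visibly symmetric in \<open>i\<close> and \<open>k\<close> except for the order of
  the factors.
\<close>

lemma signed_walks_two_base_points:
  fixes a :: "'b \<Rightarrow> 'b \<Rightarrow> quaternion"
  assumes "finite J" "i \<in> J" "k \<in> J" "i \<noteq> k"
    and cyc: "\<And>K m. K \<subset> J \<Longrightarrow> m \<in> K \<Longrightarrow> signed_walks D a K m m = D K"
  shows "signed_walks D a J i i = (\<Sum>us\<in>distinct_lists (J - {i, k}). \<Sum>vs\<in>distinct_lists (J - {i, k} - set us).
    (walk a (i # us) i * walk a (k # vs) k - walk a (i # us) k * walk a (k # vs) i) *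
    ((- 1) ^ (length us + length vs) * D (J - {i, k} - set us - set vs)))"
proof -
  define S where "S = J - {i, k}"
  define f where "f ys = (- 1) ^ length ys * walk a (i # ys) i * D (J - insert i (set ys))" for ys
  let ?c = "\<lambda>us vs. (- 1) ^ (length us + length vs) * D (S - set us - set vs)"
  have S: "finite S" "k \<notin> S" "J - {i} = insert k S"
    using assms by (auto simp: S_def)
  have avoid: "f us = (\<Sum>vs\<in>distinct_lists (S - set us). walk a (i # us) i * walk a (k # vs) k * ?c us vs)"
    if us: "us \<in> distinct_lists S" for us
  proof -
    define K where "K = J - insert i (set us)"
    have K: "K \<subset> J" "k \<in> K" "S - set us = K - {k}"
      using us assms by (auto simp: K_def S_def distinct_lists_def)
    have "(- 1) ^ length us * walk a (i # us) i *
        ((- 1) ^ length vs * walk a (k # vs) k * D (K - insert k (set vs))) =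
        walk a (i # us) i * walk a (k # vs) k * ?c us vs" for vs
    proof -
      have "K - insert k (set vs) = S - set us - set vs"
        using K(3) by blast
      then show ?thesis
        by (simp only: minus_one_powers_collect)
    qed
    moreover have "f us = (- 1) ^ length us * walk a (i # us) i * signed_walks D a K k k"
      using cyc[OF K(1,2)] by (simp add: f_def K_def)
    ultimately show ?thesis
      by (simp add: signed_walks_def sum_distrib_left K(3) del: walk.simps)
  qed
  have visit: "f (us @ k # vs) = - (walk a (i # us) k * walk a (k # vs) i * ?c us vs)" for us vs
  proof -
    have "J - insert i (set (us @ k # vs)) = S - set us - set vs"
      by (auto simp: S_def)
    moreover have "walk a (i # us @ k # vs) i = walk a (i # us) k * walk a (k # vs) i"
      using walk_append[of a "i # us" "k # vs" i] by simp
    moreover have "length (us @ k # vs) = Suc (length us + length vs)"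
      by simp
    ultimately show ?thesis
      unfolding f_def using minus_one_powers_collect[of "length us + length vs" "walk a (i # us) k" 0]
      by (simp add: mult.assoc del: walk.simps)
  qed
  have "signed_walks D a J i i = sum f (distinct_lists (insert k S))"
    using S(3) by (simp add: signed_walks_def f_def)
  also have "\<dots> = (\<Sum>us\<in>distinct_lists S. \<Sum>vs\<in>distinct_lists (S - set us). walk a (i # us) i * walk a (k # vs) k * ?c us vs) +
      (\<Sum>us\<in>distinct_lists S. \<Sum>vs\<in>distinct_lists (S - set us). - (walk a (i # us) k * walk a (k # vs) i * ?c us vs))"
    unfolding sum_distinct_lists_split[OF S(1,2)] visit by (intro arg_cong2[where f = "(+)"] sum.cong refl avoid)
  also have "\<dots> = (\<Sum>us\<in>distinct_lists S. \<Sum>vs\<in>distinct_lists (S - set us).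
      (walk a (i # us) i * walk a (k # vs) k - walk a (i # us) k * walk a (k # vs) i) * ?c us vs)"
    by (simp only: sum.distrib[symmetric] diff_conv_add_uminus distrib_right mult_minus_left)
  finally show ?thesis
    unfolding S_def .
qed

text \<open>
  Interchanging \<open>(i, us)\<close> with \<open>(k, vs)\<close> swaps the two walk factors of every term, and the
  real part of a product does not depend on their order.
\<close>

lemma QRe_signed_walks_base_point:
  fixes a :: "'b \<Rightarrow> 'b \<Rightarrow> quaternion"
  assumes "finite J" "i \<in> J" "k \<in> J"
    and cyc: "\<And>K m. K \<subset> J \<Longrightarrow> m \<in> K \<Longrightarrow> signed_walks D a K m m = D K"
    and real: "\<And>K. K \<subset> J \<Longrightarrow> D K \<in> \<real>"
  shows "QRe (signed_walks D a J i i) = QRe (signed_walks D a J k k)"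
proof (cases "i = k")
  case False
  define S where "S = J - {i, k}"
  let ?c = "\<lambda>us vs. (- 1) ^ (length us + length vs) * D (S - set us - set vs)"
  let ?T = "\<lambda>i k us vs.
    QRe ((walk a (i # us) i * walk a (k # vs) k - walk a (i # us) k * walk a (k # vs) i) * ?c us vs)"
  have S: "finite S" "J - {i, k} = S" "J - {k, i} = S"
    using assms by (auto simp: S_def)
  have swap: "?T i k us vs = ?T k i vs us" for us vs
  proof -
    have "D (S - set us - set vs) \<in> \<real>"
      using assms by (intro real) (auto simp: S_def)
    then have "?c us vs \<in> \<real>"
      by (intro Reals_mult minus_one_power_real)
    moreover have "?c us vs = ?c vs us"
      by (simp add: add.commute Diff_eq Int_ac)
    ultimately show ?thesis
      by (simp only: left_diff_distrib minus_quaternion.sel QRe_mult_swap_real[of "?c vs us"])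
  qed
  have "QRe (signed_walks D a J i i) = (\<Sum>us\<in>distinct_lists S. \<Sum>vs\<in>distinct_lists (S - set us). ?T i k us vs)"
    using signed_walks_two_base_points[OF assms(1-3) False cyc]
    unfolding S by (simp only: QRe_sum)
  also have "\<dots> = (\<Sum>vs\<in>distinct_lists S. \<Sum>us\<in>distinct_lists (S - set vs). ?T k i vs us)"
    by (simp only: swap) (rule sum_distinct_lists_swap[OF S(1)])
  also have "\<dots> = QRe (signed_walks D a J k k)"
    using signed_walks_two_base_points[OF assms(1,3,2) False[symmetric] cyc]
    unfolding S by (simp only: QRe_sum)
  finally show ?thesis .
qed simp

text \<open>
  By induction the complementary determinants in every cycle expansion are real. Reversing
  the cycles then shows that the row determinant along any index is real, and its real part
  does not depend on the index. Since real factors commute with the cycles, row and column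
  expansions agree term by term.
\<close>

lemma hermitian_dets_coincide:
  assumes "finite J"
    and "\<And>p q. p \<in> J \<Longrightarrow> q \<in> J \<Longrightarrow> a q p = qcnj (a p q)"
  shows "min_rdet a J \<in> \<real> \<and> min_cdet a J = min_rdet a J \<and>
    (\<forall>i\<in>J. rdet J a i = min_rdet a J \<and> cdet J a i = min_rdet a J)"
  using assms
proof (induction J rule: finite_psubset_induct)
  case (psubset J)
  let ?D = "min_rdet a"
  have IH: "?D K \<in> \<real>" "min_cdet a K = ?D K" "\<And>i. i \<in> K \<Longrightarrow> rdet K a i = ?D K" if "K \<subset> J" for K
  proof -
    have "a q p = qcnj (a p q)" if "p \<in> K" "q \<in> K" for p q
      by (rule psubset.prems) (use that \<open>K \<subset> J\<close> in blast)+
    from psubset.IH[OF \<open>K \<subset> J\<close> this]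
    show "?D K \<in> \<real>" "min_cdet a K = ?D K" "\<And>i. i \<in> K \<Longrightarrow> rdet K a i = ?D K"
      by blast+
  qed
  have cyc: "signed_walks ?D a K m m = ?D K" if "K \<subset> J" "m \<in> K" for K m
    using IH(3)[OF that] that finite_subset[of K J] psubset.hyps
    by (simp add: rdet_eq_signed_walks psubset_imp_subset)
  note rdet_J = rdet_eq_signed_walks[OF psubset.hyps(1)]
  have real: "rdet J a i \<in> \<real>" if "i \<in> J" for i
    using qcnj_signed_walks[of J a ?D i i, OF psubset.prems IH(1) that that]
    unfolding rdet_J[OF that] quaternion_real_iff .
  have indep: "rdet J a i = rdet J a k" if "i \<in> J" "k \<in> J" for i k
    using QRe_signed_walks_base_point[of J i k ?D a, OF psubset.hyps(1) that cyc IH(1)]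
      quaternion_real_eq[OF real[OF that(1)]] quaternion_real_eq[OF real[OF that(2)]]
    unfolding rdet_J[OF that(1)] rdet_J[OF that(2)] by metis
  have cdet_J: "cdet J a i = rdet J a i" if "i \<in> J" for i
    unfolding cdet_cycle_expansion[OF psubset.hyps(1) that] rdet_cycle_expansion[OF psubset.hyps(1) that]
  proof (rule sum.cong[OF refl])
    fix ys
    have sub: "J - insert i (set ys) \<subset> J" using that by blast
    show "(- 1) ^ length ys * min_cdet a (J - insert i (set ys)) * walk a (i # ys) i =
      (- 1) ^ length ys * walk a (i # ys) i * ?D (J - insert i (set ys))"
      unfolding IH(2)[OF sub] mult.assoc real_central[OF IH(1)[OF sub], of "walk a (i # ys) i"] ..
  qed
  show ?case
  proof (cases "J = {}")
    case True
    then show ?thesis by (simp add: min_rdet_def min_cdet_def)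
  next
    case False
    then have Min: "Min J \<in> J" using psubset.hyps by simp
    then have "?D J = rdet J a (Min J)" "min_cdet a J = cdet J a (Min J)"
      using False by (simp_all add: min_rdet_def min_cdet_def)
    then show ?thesis
      using Min real indep cdet_J by metis
  qed
qed

section \<open>Cofactors as entries of the adjugate\<close>

lemma min_rdet_cong:
  assumes "finite J" "\<And>p q. p \<in> J \<Longrightarrow> q \<in> J \<Longrightarrow> a p q = b p q"
  shows "min_rdet a J = min_rdet b J"
  using assms
proof (induction J rule: finite_psubset_induct)
  case (psubset J)
  show ?case
  proof (cases "J = {}")
    case False
    let ?m = "Min J"
    have m: "?m \<in> J" using False psubset.hyps by simp
    have "min_rdet a (J - insert ?m (set ys)) = min_rdet b (J - insert ?m (set ys))" for ys
      using m by (intro psubset.IH psubset.prems) auto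
    moreover have "walk a (?m # ys) ?m = walk b (?m # ys) ?m" if "ys \<in> distinct_lists (J - {?m})" for ys
      using m that by (intro walk_cong psubset.prems) (auto simp: distinct_lists_def)
    ultimately have "rdet J a ?m = rdet J b ?m"
      unfolding rdet_cycle_expansion[OF psubset.hyps(1) m] by (intro sum.cong refl) metis
    then show ?thesis by (simp add: min_rdet_def)
  qed (simp add: min_rdet_def)
qed

lemma min_cdet_cong:
  assumes "finite J" "\<And>p q. p \<in> J \<Longrightarrow> q \<in> J \<Longrightarrow> a p q = b p q"
  shows "min_cdet a J = min_cdet b J"
  using assms
proof (induction J rule: finite_psubset_induct)
  case (psubset J)
  show ?case
  proof (cases "J = {}")
    case False
    let ?m = "Min J"
    have m: "?m \<in> J" using False psubset.hyps by simp
    have "min_cdet a (J - insert ?m (set ys)) = min_cdet b (J - insert ?m (set ys))" for ys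
      using m by (intro psubset.IH psubset.prems) auto
    moreover have "walk a (?m # ys) ?m = walk b (?m # ys) ?m" if "ys \<in> distinct_lists (J - {?m})" for ys
      using m that by (intro walk_cong psubset.prems) (auto simp: distinct_lists_def)
    ultimately have "cdet J a ?m = cdet J b ?m"
      unfolding cdet_cycle_expansion[OF psubset.hyps(1) m] by (intro sum.cong refl) metis
    then show ?thesis by (simp add: min_cdet_def)
  qed (simp add: min_cdet_def)
qed

lemma walk_replace_col:
  "j \<notin> set (tl xs) \<Longrightarrow> walk (replace_col a j (\<lambda>p. a p i)) xs j = walk a xs i"
proof (induction xs)
  case (Cons x xs)
  then have "j \<notin> set xs" by simp
  then have "walk (replace_col a j (\<lambda>p. a p i)) xs j = walk a xs i"
    by (intro Cons.IH) (cases xs; simp)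
  with \<open>j \<notin> set xs\<close> show ?case
    by (cases xs) (auto simp: replace_col_def)
qed simp

lemma walk_replace_row:
  assumes "i \<notin> set ys"
  shows "walk (replace_row a i (a j)) (i # ys) y = walk a (j # ys) y"
proof -
  have "walk (replace_row a i (a j)) ys y = walk a ys y"
    using assms by (intro walk_cong) (auto simp: replace_row_def)
  then show ?thesis by (simp add: replace_row_def)
qed

text \<open>
  Among all cycles only the one through \<open>j\<close> meets the replaced column, in its last factor.
  There the replacement redirects the final step from \<open>j\<close> to the deleted index \<open>i\<close>, so the
  closed walk becomes a walk from \<open>j\<close> to \<open>i\<close>.
\<close>

lemma rdet_replace_col:
  fixes a :: "nat \<Rightarrow> nat \<Rightarrow> 'a::ring_1"
  assumes "finite I" "j \<in> I" "i \<noteq> j"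
  shows "rdet (I - {i}) (replace_col a j (\<lambda>p. a p i)) j = signed_walks (min_rdet a) a I j i"
proof -
  let ?b = "replace_col a j (\<lambda>p. a p i)"
  have "finite (I - {i})" "j \<in> I - {i}" using assms by auto
  from rdet_cycle_expansion[OF this, of ?b]
  have "rdet (I - {i}) ?b j = (\<Sum>ys\<in>distinct_lists (I - {j, i}).
    (- 1) ^ length ys * walk ?b (j # ys) j * min_rdet ?b (I - insert j (insert i (set ys))))"
    by (simp add: Diff_insert2[symmetric] insert_commute del: walk.simps)
  also have "\<dots> = signed_walks (min_rdet a) a I j i"
    unfolding signed_walks_def
  proof (rule sum.cong[OF refl])
    fix ys assume "ys \<in> distinct_lists (I - {j, i})"
    then have "walk ?b (j # ys) j = walk a (j # ys) i"
      by (intro walk_replace_col) (auto simp: distinct_lists_def)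
    moreover have "min_rdet ?b (I - insert j (insert i (set ys))) = min_rdet a (I - insert j (insert i (set ys)))"
      using assms by (intro min_rdet_cong) (auto simp: replace_col_def)
    ultimately show "(- 1) ^ length ys * walk ?b (j # ys) j * min_rdet ?b (I - insert j (insert i (set ys))) =
      (- 1) ^ length ys * walk a (j # ys) i * min_rdet a (I - insert j (insert i (set ys)))"
      by (simp only:)
  qed
  finally show ?thesis .
qed

text \<open>
  Replacing row \<open>i\<close> changes the first step of the cycle through \<open>i\<close>, which now starts from the
  deleted index \<open>j\<close>. So left and right cofactors are sums over the same walks.
\<close>

lemma cdet_replace_row:
  fixes a :: "nat \<Rightarrow> nat \<Rightarrow> 'a::ring_1"
  assumes "finite I" "i \<in> I" "i \<noteq> j"
  shows "cdet (I - {j}) (replace_row a i (a j)) i = (\<Sum>ys\<in>distinct_lists (I - {j, i}).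
    (- 1) ^ length ys * min_cdet a (I - insert j (insert i (set ys))) * walk a (j # ys) i)"
proof -
  let ?b = "replace_row a i (a j)"
  have "finite (I - {j})" "i \<in> I - {j}" using assms by auto
  from cdet_cycle_expansion[OF this, of ?b]
  have "cdet (I - {j}) ?b i = (\<Sum>ys\<in>distinct_lists (I - {j, i}).
    (- 1) ^ length ys * min_cdet ?b (I - insert j (insert i (set ys))) * walk ?b (i # ys) i)"
    by (simp add: Diff_insert2[symmetric] insert_commute del: walk.simps)
  also have "\<dots> = (\<Sum>ys\<in>distinct_lists (I - {j, i}).
    (- 1) ^ length ys * min_cdet a (I - insert j (insert i (set ys))) * walk a (j # ys) i)"
  proof (rule sum.cong[OF refl])
    fix ys assume "ys \<in> distinct_lists (I - {j, i})"
    then have "walk ?b (i # ys) i = walk a (j # ys) i"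
      by (intro walk_replace_row) (auto simp: distinct_lists_def)
    moreover have "min_cdet ?b (I - insert j (insert i (set ys))) = min_cdet a (I - insert j (insert i (set ys)))"
      using assms by (intro min_cdet_cong) (auto simp: replace_row_def)
    ultimately show "(- 1) ^ length ys * min_cdet ?b (I - insert j (insert i (set ys))) * walk ?b (i # ys) i =
      (- 1) ^ length ys * min_cdet a (I - insert j (insert i (set ys))) * walk a (j # ys) i"
      by (simp only:)
  qed
  finally show ?thesis .
qed

section \<open>The inverse of a Hermitian matrix\<close>

lemma inverse_unique_mat:
  fixes A X Y :: "'a::semiring_1 mat"
  assumes "A \<in> carrier_mat n n" "X \<in> carrier_mat n n" "Y \<in> carrier_mat n n"
    and "X * A = 1\<^sub>m n" "A * Y = 1\<^sub>m n"
  shows "X = Y"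
proof -
  have "X = X * (A * Y)" using assms by simp
  also have "\<dots> = (X * A) * Y" by (rule assoc_mult_mat[OF assms(2,1,3), symmetric])
  also have "\<dots> = Y" using assms by simp
  finally show ?thesis .
qed

context
  fixes n :: nat and A :: "quaternion mat"
  assumes n: "n \<ge> 1" and A: "A \<in> carrier_mat n n" and herm: "hermitian A"
begin

lemma entries_hermitian:
  assumes "p \<in> {..<n}" "q \<in> {..<n}"
  shows "entries A q p = qcnj (entries A p q)"
proof -
  have "A $$ (q, p) = conj_transpose A $$ (q, p)"
    using herm by (simp add: hermitian_def)
  also have "\<dots> = qcnj (A $$ (p, q))"
    using A assms by (simp add: conj_transpose_def)
  finally show ?thesis by (simp add: entries_def)
qed

lemma hermitian_minors:
  assumes "J \<subseteq> {..<n}"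
  shows "min_rdet (entries A) J \<in> \<real>"
    and "min_cdet (entries A) J = min_rdet (entries A) J"
    and "i \<in> J \<Longrightarrow> rdet J (entries A) i = min_rdet (entries A) J"
    and "i \<in> J \<Longrightarrow> cdet J (entries A) i = min_rdet (entries A) J"
proof -
  have "finite J" using assms by (rule finite_subset) simp
  moreover have "entries A q p = qcnj (entries A p q)" if "p \<in> J" "q \<in> J" for p q
    by (rule entries_hermitian) (use that assms in blast)+
  ultimately have "min_rdet (entries A) J \<in> \<real> \<and> min_cdet (entries A) J = min_rdet (entries A) J \<and>
    (\<forall>i\<in>J. rdet J (entries A) i = min_rdet (entries A) J \<and> cdet J (entries A) i = min_rdet (entries A) J)"
    by (rule hermitian_dets_coincide)
  then show "min_rdet (entries A) J \<in> \<real>"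
    and "min_cdet (entries A) J = min_rdet (entries A) J"
    and "i \<in> J \<Longrightarrow> rdet J (entries A) i = min_rdet (entries A) J"
    and "i \<in> J \<Longrightarrow> cdet J (entries A) i = min_rdet (entries A) J"
    by blast+
qed

lemma of_real_hermitian_det: "of_real (hermitian_det A) = min_rdet (entries A) {..<n}"
proof -
  let ?d = "QRe (min_rdet (entries A) {..<n})"
  have d: "min_rdet (entries A) {..<n} = of_real ?d"
    by (rule quaternion_real_eq[OF hermitian_minors(1)]) simp
  have "hermitian_det A = ?d"
    unfolding hermitian_det_def
  proof (rule the_equality)
    show "\<forall>i<dim_row A. rdet {..<dim_row A} (entries A) i = of_real ?d \<and>
        cdet {..<dim_row A} (entries A) i = of_real ?d"
      using A d hermitian_minors(3,4)[of "{..<n}"] by auto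
  next
    fix r assume "\<forall>i<dim_row A. rdet {..<dim_row A} (entries A) i = of_real r \<and>
        cdet {..<dim_row A} (entries A) i = of_real r"
    \<comment> \<open>As \<open>n \<ge> 1\<close>, the index \<open>0\<close> determines the value.\<close>
    then have "of_real r = min_rdet (entries A) {..<n}"
      using A n hermitian_minors(3)[of "{..<n}" 0] by auto
    then show "r = ?d" by (metis of_real_components(1))
  qed
  with d show ?thesis by simp
qed

abbreviation adj where
  "adj \<equiv> adjugate (min_rdet (entries A)) (entries A) {..<n}"

lemma index_set_remove_eq_empty_iff: "i < n \<Longrightarrow> {..<n} - {i} = {} \<longleftrightarrow> n = 1"
proof -
  assume "i < n"
  then have "card ({..<n} - {i}) = n - 1" by simp
  then show ?thesis
    using n by (metis card.empty card_eq_0_iff diff_is_0_eq finite_Diff finite_lessThan le_antisym le_numeral_extra(4))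
qed

lemma right_cofactor_eq:
  assumes "i < n" "j < n"
  shows "right_cofactor A i j = adj j i"
proof (cases "i = j")
  case True
  then show ?thesis
    using A index_set_remove_eq_empty_iff[OF assms(1)]
    by (simp add: right_cofactor_def adjugate_def min_rdet_def Let_def del: Diff_eq_empty_iff)
next
  case False
  then show ?thesis
    using A assms rdet_replace_col[of "{..<n}" j i "entries A"]
    by (simp add: right_cofactor_def adjugate_def Let_def)
qed

lemma left_cofactor_eq:
  assumes "i < n" "j < n"
  shows "left_cofactor A i j = adj j i"
proof (cases "i = j")
  case True
  have "left_cofactor A i j = min_cdet (entries A) ({..<n} - {j})"
    using True A index_set_remove_eq_empty_iff[OF assms(1)]
    by (simp add: left_cofactor_def min_cdet_def Let_def del: Diff_eq_empty_iff)
  also have "\<dots> = adj j i"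
    using True hermitian_minors(2)[OF Diff_subset] by (simp add: adjugate_def)
  finally show ?thesis .
next
  case False
  have "cdet ({..<n} - {j}) (replace_row (entries A) i (entries A j)) i =
      signed_walks (min_rdet (entries A)) (entries A) {..<n} j i"
    unfolding cdet_replace_row[OF finite_lessThan lessThan_iff[THEN iffD2, OF assms(1)] False]
      signed_walks_def
  proof (rule sum.cong[OF refl])
    fix ys
    let ?K = "{..<n} - insert j (insert i (set ys))" and ?w = "walk (entries A) (j # ys) i"
    show "(- 1) ^ length ys * min_cdet (entries A) ?K * ?w =
        (- 1) ^ length ys * ?w * min_rdet (entries A) ?K"
      unfolding hermitian_minors(2)[OF Diff_subset] mult.assoc
        real_central[OF hermitian_minors(1)[OF Diff_subset], of _ ?w] ..
  qed
  then show ?thesis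
    using A False by (simp add: left_cofactor_def adjugate_def Let_def)
qed

lemma qcnj_adj:
  assumes "i < n" "j < n"
  shows "qcnj (adj i j) = adj j i"
proof (cases "i = j")
  case True
  have "min_rdet (entries A) ({..<n} - {j}) \<in> \<real>"
    by (rule hermitian_minors(1)) auto
  with True show ?thesis by (simp add: adjugate_def quaternion_real_iff)
next
  case False
  have neg: "qcnj (- x) = - qcnj x" for x by (simp add: quaternion_eq_iff)
  have "qcnj (signed_walks (min_rdet (entries A)) (entries A) {..<n} i j) =
      signed_walks (min_rdet (entries A)) (entries A) {..<n} j i"
    by (rule qcnj_signed_walks, rule entries_hermitian, assumption+, rule hermitian_minors(1))
      (use assms in auto)
  with False show ?thesis by (simp add: adjugate_def neg)
qed

lemma matrix_times_adj:
  assumes "i < n" "k < n"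
  shows "(\<Sum>j<n. entries A i j * adj j k) = (if i = k then of_real (hermitian_det A) else 0)"
  unfolding of_real_hermitian_det
proof (rule matrix_times_adjugate)
  fix J and x :: quaternion assume J: "J \<subseteq> {..<n}"
  show "min_rdet (entries A) J * x = x * min_rdet (entries A) J"
    by (rule real_central[OF hermitian_minors(1)[OF J]])
  fix i assume "i \<in> J"
  then show "signed_walks (min_rdet (entries A)) (entries A) J i i = min_rdet (entries A) J"
    using hermitian_minors(3)[OF J] finite_subset[OF J] by (simp add: rdet_eq_signed_walks)
qed (use assms in auto)

text \<open>
  The matrix and its adjugate are both Hermitian, so their product in the other order is
  the conjugate transpose of the scalar matrix just found.
\<close>

lemma adj_times_matrix:
  assumes "i < n" "k < n"
  shows "(\<Sum>j<n. adj i j * entries A j k) = (if i = k then of_real (hermitian_det A) else 0)"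
proof -
  have "(\<Sum>j<n. adj i j * entries A j k) = qcnj (\<Sum>j<n. entries A k j * adj j i)"
    unfolding qcnj_sum qcnj_mult
  proof (rule sum.cong[OF refl])
    fix j assume "j \<in> {..<n}"
    then show "adj i j * entries A j k = qcnj (adj j i) * qcnj (entries A k j)"
      using assms qcnj_adj[of j i] entries_hermitian[of k j] by simp
  qed
  also have "\<dots> = qcnj (if k = i then of_real (hermitian_det A) else 0)"
    using assms by (simp only: matrix_times_adj)
  finally show ?thesis
    by (auto simp: quaternion_eq_iff of_real_components)
qed

lemma scaled_adj_inverse:
  assumes "hermitian_det A \<noteq> 0"
  defines "X \<equiv> of_real (1 / hermitian_det A) \<cdot>\<^sub>m mat n n (\<lambda>(i, j). adj i j)"
  shows "A * X = 1\<^sub>m n" "X * A = 1\<^sub>m n"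
proof -
  let ?c = "of_real (1 / hermitian_det A) :: quaternion"
  have c: "?c * of_real (hermitian_det A) = 1"
    using assms(1) by (simp only: of_real_mult[symmetric]) simp
  have c_central: "x * (?c * y) = ?c * (x * y)" for x y
    using real_central[OF Reals_of_real, of _ x] by (simp only: mult.assoc[symmetric])
  have X: "X \<in> carrier_mat n n" by (simp add: X_def)
  have X_entry: "X $$ (i, j) = ?c * adj i j" if "i < n" "j < n" for i j
    using that by (simp add: X_def)
  show "A * X = 1\<^sub>m n"
  proof (rule eq_matI)
    fix i k assume "i < dim_row (1\<^sub>m n :: quaternion mat)" "k < dim_col (1\<^sub>m n :: quaternion mat)"
    then have ik: "i < n" "k < n" by auto
    have "(A * X) $$ (i, k) = (\<Sum>j<n. entries A i j * (?c * adj j k))"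
      using A X ik X_entry by (simp add: scalar_prod_def entries_def atLeast0LessThan)
    also have "\<dots> = ?c * (\<Sum>j<n. entries A i j * adj j k)"
      by (simp only: sum_distrib_left c_central)
    also have "\<dots> = 1\<^sub>m n $$ (i, k)"
      using ik c by (simp only: matrix_times_adj) simp
    finally show "(A * X) $$ (i, k) = 1\<^sub>m n $$ (i, k)" .
  qed (use A X in auto)
  show "X * A = 1\<^sub>m n"
  proof (rule eq_matI)
    fix i k assume "i < dim_row (1\<^sub>m n :: quaternion mat)" "k < dim_col (1\<^sub>m n :: quaternion mat)"
    then have ik: "i < n" "k < n" by auto
    have "(X * A) $$ (i, k) = (\<Sum>j<n. ?c * adj i j * entries A j k)"
      using A X ik X_entry by (simp add: scalar_prod_def entries_def atLeast0LessThan)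
    also have "\<dots> = ?c * (\<Sum>j<n. adj i j * entries A j k)"
      by (simp only: sum_distrib_left mult.assoc)
    also have "\<dots> = 1\<^sub>m n $$ (i, k)"
      using ik c by (simp only: adj_times_matrix) simp
    finally show "(X * A) $$ (i, k) = 1\<^sub>m n $$ (i, k)" .
  qed (use A X in auto)
qed

end

theorem theorem5p1:
  fixes n :: nat and A :: "quaternion mat"
  assumes "n \<ge> 1"
    and "A \<in> carrier_mat n n"
    and "hermitian A"
    and "hermitian_det A \<noteq> 0"
  shows "(\<exists>!X. is_right_inverse A X) \<and>
    (\<exists>!X. is_left_inverse A X) \<and>
    right_inverse A = left_inverse A \<and>
    right_inverse A =
      of_real (1 / hermitian_det A) \<cdot>\<^sub>m mat n n (\<lambda>(i, j). right_cofactor A j i) \<and>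
    left_inverse A =
      of_real (1 / hermitian_det A) \<cdot>\<^sub>m mat n n (\<lambda>(i, j). left_cofactor A j i)"
proof -
  note ctxt = assms(1-3)
  define X where "X = of_real (1 / hermitian_det A) \<cdot>\<^sub>m mat n n (\<lambda>(i, j). adj n A i j)"
  have X: "X \<in> carrier_mat n n" "A * X = 1\<^sub>m n" "X * A = 1\<^sub>m n"
    using scaled_adj_inverse[OF ctxt assms(4)] by (simp_all add: X_def)
  have right: "mat n n (\<lambda>(i, j). right_cofactor A j i) = mat n n (\<lambda>(i, j). adj n A i j)"
    by (rule cong_mat) (simp_all add: right_cofactor_eq[OF ctxt])
  have left: "mat n n (\<lambda>(i, j). left_cofactor A j i) = mat n n (\<lambda>(i, j). adj n A i j)"
    by (rule cong_mat) (simp_all add: left_cofactor_eq[OF ctxt])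
  have dims: "dim_row A = n" "dim_col A = n"
    using assms(2) by auto
  have right_iff: "is_right_inverse A Y \<longleftrightarrow> Y = X" for Y
  proof
    assume "is_right_inverse A Y"
    then have "Y \<in> carrier_mat n n" "A * Y = 1\<^sub>m n"
      by (simp_all add: is_right_inverse_def inverts_mat_def dims)
    from inverse_unique_mat[OF assms(2) X(1) this(1) X(3) this(2)] show "Y = X"
      by (rule sym)
  qed (use X in \<open>simp add: is_right_inverse_def inverts_mat_def dims\<close>)
  have left_iff: "is_left_inverse A Y \<longleftrightarrow> Y = X" for Y
  proof
    assume "is_left_inverse A Y"
    then have Y: "Y \<in> carrier_mat n n" "Y * A = 1\<^sub>m n"
      by (auto simp add: is_left_inverse_def inverts_mat_def dims)
    show "Y = X"
      by (rule inverse_unique_mat[OF assms(2) Y(1) X(1) Y(2) X(2)])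
  qed (use X in \<open>auto simp: is_left_inverse_def inverts_mat_def dims\<close>)
  have "right_inverse A = X" "left_inverse A = X"
    by (simp_all add: right_inverse_def left_inverse_def right_iff left_iff)
  then show ?thesis
    unfolding right left by (simp add: right_iff left_iff X_def)
qed

end
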